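(* Consider the problem of minimizing $f(x)$ over $x\in\mathbb{R}^n$ subject to $c_i(x)=0$ for $i\in\mathcal{E}$ and $c_i(x)\le 0$ for $i\in\mathcal{I}$. Suppose that this problem is convex (that is, $f$ and $c_i$, $i\in\mathcal{I}$, are convex and $c_i$, $i\in\mathcal{E}$, are affine) and that Slater's condition is satisfied. Let $\rho>0$ and let $\mathbb{L}_\rho(x,\lambda,\mu)$ be the augmented Lagrangian function of the problem. Then strong duality holds for the saddle point problem $\min_x\max_{\lambda,\mu}\mathbb{L}_\rho(x,\lambda,\mu)$, that is, $$\max_{\lambda,\mu}\min_{x}\ \mathbb{L}_\rho(x,\lambda,\mu)=\min_{x}\max_{\lambda,\mu}\ \mathbb{L}_\rho(x,\lambda,\mu),$$ where $x$ ranges over $\mathbb{R}^n$, $\lambda$ over $\mathbb{R}^{|\mathcal{E}|}$ and $\mu$ over $\mathbb{R}^{|\mathcal{I}|}$ (no sign constraint on $\mu$).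
   Context: $\mathcal{E}$ and $\mathcal{I}$ are disjoint finite index sets; $f:\mathbb{R}^n\to\mathbb{R}$ and $c_i:\mathbb{R}^n\to\mathbb{R}$ ($i\in\mathcal{E}\cup\mathcal{I}$) are proper and lower semicontinuous functions. Write $[\alpha]_+=\max\{\alpha,0\}$. Augmented Lagrangian: for $\rho>0$, $\lambda\in\mathbb{R}^{|\mathcal{E}|}$, $\mu\in\mathbb{R}^{|\mathcal{I}|}$, $$\mathbb{L}_\rho(x,\lambda,\mu)=f(x)+\sum_{i\in\mathcal{E}}\lambda_i c_i(x)+\frac{\rho}{2}\sum_{i\in\mathcal{E}}c_i^2(x)+\frac{\rho}{2}\sum_{i\in\mathcal{I}}\left(\left[\frac{\mu_i}{\rho}+c_i(x)\right]_+^2-\frac{\mu_i^2}{\rho^2}\right).$$ Slater's condition: let $\mathcal{D}=\bigcap_{i\in\mathcal{E}\cup\mathcal{I}}\mathrm{dom}(c_i)\cap\mathrm{dom}(f)$. Suppose $f$ and $c_j$, $j\in\mathcal{I}$, are convex and $c_i$ is affine for each $i\in\mathcal{E}\cup\mathcal{J}$, where $\mathcal{J}\subset\mathcal{I}$ is a (possibly empty) subset. Slater's condition holds if there is a feasible $x$ in the relative interior of $\mathcal{D}$ such that $c_i(x)=0$ for $i\in\mathcal{E}$, $c_j(x)\le0$ for $j\in\mathcal{J}$, and $c_k(x)<0$ for $k\in\mathcal{I}\setminus\mathcal{J}$. In the displayed equality, $\min$ and $\max$ are understood as infimum and supremum with values in $[-\infty,+\infty]$. *)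

theory Defs
  imports "HOL-Analysis.Analysis"
begin

text \<open>
  Objective and constraint functions take values in \<open>ereal\<close>, so that properness, effective
  domains and the relative interior in Slater's condition have their usual meaning; a real-valued
  function \<open>h\<close> is the special case \<open>\<lambda>x. ereal (h x)\<close>.
\<close>

definition eff_dom :: "('a \<Rightarrow> ereal) \<Rightarrow> 'a set" where
  "eff_dom g = {x. g x < \<infinity>}"

definition proper_fun :: "('a \<Rightarrow> ereal) \<Rightarrow> bool" where
  "proper_fun g \<longleftrightarrow> (\<forall>x. g x \<noteq> -\<infinity>) \<and> (\<exists>x. g x \<noteq> \<infinity>)"

definition lsc_fun :: "('a::topological_space \<Rightarrow> ereal) \<Rightarrow> bool" where
  "lsc_fun g \<longleftrightarrow> (\<forall>x. g x \<le> Liminf (at x) g)"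

text \<open>Only applied to proper functions, so the right-hand side is never \<open>\<infinity> - \<infinity>\<close>.\<close>

definition convex_fun :: "('a::real_vector \<Rightarrow> ereal) \<Rightarrow> bool" where
  "convex_fun g \<longleftrightarrow> (\<forall>x y. \<forall>t\<in>{0<..<1::real}.
     g ((1 - t) *\<^sub>R x + t *\<^sub>R y) \<le> ereal (1 - t) * g x + ereal t * g y)"

definition affine_fun :: "('a::real_inner \<Rightarrow> ereal) \<Rightarrow> bool" where
  "affine_fun g \<longleftrightarrow> (\<exists>a b. \<forall>x. g x = ereal (a \<bullet> x + b))"

definition feasible_set :: "'i set \<Rightarrow> 'i set \<Rightarrow> ('i \<Rightarrow> 'a \<Rightarrow> ereal) \<Rightarrow> 'a set" where
  "feasible_set E I c = {x. (\<forall>i\<in>E. c i x = 0) \<and> (\<forall>i\<in>I. c i x \<le> 0)}"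

definition convex_problem ::
  "'i set \<Rightarrow> 'i set \<Rightarrow> ('a::real_inner \<Rightarrow> ereal) \<Rightarrow> ('i \<Rightarrow> 'a \<Rightarrow> ereal) \<Rightarrow> bool" where
  "convex_problem E I f c \<longleftrightarrow>
     convex_fun f \<and> (\<forall>i\<in>I. convex_fun (c i)) \<and> (\<forall>i\<in>E. affine_fun (c i))"

definition problem_dom ::
  "'i set \<Rightarrow> 'i set \<Rightarrow> ('a \<Rightarrow> ereal) \<Rightarrow> ('i \<Rightarrow> 'a \<Rightarrow> ereal) \<Rightarrow> 'a set" where
  "problem_dom E I f c = (\<Inter>i\<in>E \<union> I. eff_dom (c i)) \<inter> eff_dom f"

text \<open>
  \<open>J\<close> collects inequality constraints that are affine and hence need not be strict at the
  Slater point; it may be empty.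
\<close>

definition slater_condition ::
  "'i set \<Rightarrow> 'i set \<Rightarrow> ('a::euclidean_space \<Rightarrow> ereal) \<Rightarrow> ('i \<Rightarrow> 'a \<Rightarrow> ereal) \<Rightarrow> bool" where
  "slater_condition E I f c \<longleftrightarrow>
     (\<exists>J\<subseteq>I. (\<forall>j\<in>J. affine_fun (c j)) \<and>
       (\<exists>x \<in> feasible_set E I c \<inter> rel_interior (problem_dom E I f c).
          (\<forall>i\<in>E. c i x = 0) \<and> (\<forall>j\<in>J. c j x \<le> 0) \<and> (\<forall>k\<in>I - J. c k x < 0)))"

text \<open>\<open>\<real>\<^sup>E \<times> \<real>\<^sup>I\<close>; \<open>\<rightarrow>\<^sub>E\<close> represents vectors indexed by a set as extensional functions.\<close>

definition multipliers :: "'i set \<Rightarrow> 'i set \<Rightarrow> (('i \<Rightarrow> real) \<times> ('i \<Rightarrow> real)) set" where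
  "multipliers E I = (E \<rightarrow>\<^sub>E UNIV) \<times> (I \<rightarrow>\<^sub>E UNIV)"

definition aug_lagrangian ::
  "'i set \<Rightarrow> 'i set \<Rightarrow> ('a \<Rightarrow> ereal) \<Rightarrow> ('i \<Rightarrow> 'a \<Rightarrow> ereal) \<Rightarrow> real \<Rightarrow>
    'a \<Rightarrow> ('i \<Rightarrow> real) \<Rightarrow> ('i \<Rightarrow> real) \<Rightarrow> ereal" where
  "aug_lagrangian E I f c \<rho> x l \<mu> =
     f x + (\<Sum>i\<in>E. ereal (l i) * c i x)
         + ereal (\<rho> / 2) * (\<Sum>i\<in>E. (c i x)\<^sup>2)
         + ereal (\<rho> / 2) *
             (\<Sum>i\<in>I. (max (ereal (\<mu> i / \<rho>) + c i x) 0)\<^sup>2 - ereal ((\<mu> i)\<^sup>2 / \<rho>\<^sup>2))"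

end

theory Submission
  imports Defs
begin

text \<open>
  For every feasible point the augmented Lagrangian is at most \<open>f\<close>, whatever the multipliers are, so
  the right-hand side is at most the optimal value \<open>p\<close> of the problem. In the other direction, for
  \<open>\<mu> \<ge> 0\<close> the augmented Lagrangian dominates the ordinary Lagrangian
  \<open>f + \<Sum> l\<^sub>i c\<^sub>i + \<Sum> \<mu>\<^sub>i c\<^sub>i\<close>, because \<open>(\<rho>/2) ([m/\<rho> + c]\<^sub>+\<^sup>2 - m\<^sup>2/\<rho>\<^sup>2) \<ge> m c\<close>
  (lemma \<open>penalty_ge_linear\<close>), and outside the problem domain it is \<open>\<infinity>\<close>. Hence, for finite \<open>p\<close>, it
  suffices to find multipliers for which the ordinary Lagrangian is at least \<open>p\<close> on the problem
  domain (theorem \<open>lagrange_multipliers\<close>); weak duality gives the remaining inequality.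

  The multipliers are produced one constraint at a time. Suppose that \<open>g \<ge> p\<close> wherever \<open>h \<le> 0\<close>, with
  \<open>g\<close> and \<open>h\<close> convex. A segment from a point \<open>x\<close> with \<open>h x > 0\<close> to a point \<open>y\<close> with \<open>h y < 0\<close> meets
  \<open>h \<le> 0\<close>, and convexity of \<open>g\<close> along it says \<open>(p - g x) / h x \<le> (g y - p) / - h y\<close>. Any number \<open>m\<close>
  between all the left-hand sides and all the right-hand sides satisfies \<open>p \<le> g + m h\<close>. This
  treats constraints that are strict at the Slater point.

  Affine constraints need not be strict anywhere, and here the relative interior enters: an
  affine function that is nonnegative on the domain and vanishes at a relative interior point
  vanishes identically. So if an affine constraint \<open>a\<^sub>k \<le> 0\<close> cannot be made strict on the set cut out
  by the other affine constraints, then, by induction applied to the objective \<open>a\<^sub>k\<close> itself, some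
  combination \<open>a\<^sub>k + \<Sum> \<lambda>\<^sub>j a\<^sub>j\<close> with \<open>\<lambda> \<ge> 0\<close> is identically zero. Then \<open>a\<^sub>k\<close> may be treated as an
  equality constraint, and a negative multiplier obtained for it is repaired by adding a multiple
  of that zero combination.
\<close>

section \<open>Affine functions and relatively interior points of a convex set\<close>

definition affine_on :: "'a::real_vector set \<Rightarrow> ('a \<Rightarrow> real) \<Rightarrow> bool" where
  "affine_on C h \<longleftrightarrow> convex C \<and>
     (\<forall>x\<in>C. \<forall>y\<in>C. \<forall>t\<in>{0..1}. h ((1 - t) *\<^sub>R x + t *\<^sub>R y) = (1 - t) * h x + t * h y)"

text \<open>
  The algebraic form of membership in the relative interior: every segment of \<open>C\<close> that ends in \<open>z\<close>
  can be prolonged beyond \<open>z\<close>. Unlike the topological form, it visibly survives cutting \<open>C\<close> with a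
  hyperplane through \<open>z\<close>.
\<close>

definition rel_core :: "'a::real_vector set \<Rightarrow> 'a set" where
  "rel_core C =
     {z \<in> C. \<forall>x\<in>C. \<exists>y\<in>C. \<exists>t\<in>{0<..<1}. z = (1 - t) *\<^sub>R x + t *\<^sub>R y}"

lemma rel_interior_subset_rel_core:
  fixes C :: "'a::euclidean_space set"
  assumes "convex C"
  shows "rel_interior C \<subseteq> rel_core C"
proof
  fix z assume z: "z \<in> rel_interior C"
  then have zC: "z \<in> C" using rel_interior_subset by blast
  moreover have "\<exists>y\<in>C. \<exists>t\<in>{0<..<1}. z = (1 - t) *\<^sub>R x + t *\<^sub>R y" if "x \<in> C" for x
  proof -
    obtain e where e: "e > 1" "(1 - e) *\<^sub>R x + e *\<^sub>R z \<in> C"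
      using convex_rel_interior_iff[OF assms, of z] z zC \<open>x \<in> C\<close> by blast
    have "(1 - 1/e) *\<^sub>R x + (1/e) *\<^sub>R ((1 - e) *\<^sub>R x + e *\<^sub>R z)
        = ((1 - 1/e) + (1/e) * (1 - e)) *\<^sub>R x + z"
      using e(1) by (simp only: scaleR_add_right scaleR_add_left scaleR_scaleR) simp
    also have "(1 - 1/e) + (1/e) * (1 - e) = 0"
      using e(1) by (simp add: field_simps)
    finally have "z = (1 - 1/e) *\<^sub>R x + (1/e) *\<^sub>R ((1 - e) *\<^sub>R x + e *\<^sub>R z)" by simp
    moreover have "1/e \<in> {0<..<1}" using e(1) by simp
    ultimately show ?thesis using e(2) by blast
  qed
  ultimately show "z \<in> rel_core C" by (simp add: rel_core_def)
qed

lemma affine_on_imp_convex_on: "affine_on C h \<Longrightarrow> convex_on C h"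
  by (intro convex_onI) (auto simp: affine_on_def)

lemma affine_on_subset: "affine_on C h \<Longrightarrow> S \<subseteq> C \<Longrightarrow> convex S \<Longrightarrow> affine_on S h"
  unfolding affine_on_def by blast

lemma affine_on_lincomb:
  assumes "convex C" and "\<And>j. j \<in> J \<Longrightarrow> affine_on C (h j)"
  shows "affine_on C (\<lambda>x. \<Sum>j\<in>J. w j * h j x)"
proof -
  have "(\<Sum>j\<in>J. w j * h j ((1 - t) *\<^sub>R x + t *\<^sub>R y))
      = (1 - t) * (\<Sum>j\<in>J. w j * h j x) + t * (\<Sum>j\<in>J. w j * h j y)"
    if "x \<in> C" "y \<in> C" "t \<in> {0..1}" for x y t
  proof -
    have "(\<Sum>j\<in>J. w j * h j ((1 - t) *\<^sub>R x + t *\<^sub>R y))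
        = (\<Sum>j\<in>J. (1 - t) * (w j * h j x) + t * (w j * h j y))"
    proof (rule sum.cong[OF refl])
      fix j assume "j \<in> J"
      then have "h j ((1 - t) *\<^sub>R x + t *\<^sub>R y) = (1 - t) * h j x + t * h j y"
        using assms(2) that unfolding affine_on_def by blast
      then show "w j * h j ((1 - t) *\<^sub>R x + t *\<^sub>R y) = (1 - t) * (w j * h j x) + t * (w j * h j y)"
        by (simp add: distrib_left mult.left_commute)
    qed
    then show ?thesis by (simp add: sum.distrib sum_distrib_left)
  qed
  with assms(1) show ?thesis by (simp add: affine_on_def)
qed

lemma convex_on_add_scaled:
  assumes "convex_on C g" "convex_on C h" "0 \<le> (m::real)"
  shows "convex_on C (\<lambda>x. g x + m * h x)"
  using assms by (intro convex_on_add convex_on_cmul)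

lemma convex_sublevel:
  assumes "convex C" and "\<And>j. j \<in> J \<Longrightarrow> convex_on C (h j)"
  shows "convex {x\<in>C. \<forall>j\<in>J. h j x \<le> (0::real)}"
proof (rule convexI)
  fix x y and u v :: real
  assume x: "x \<in> {x\<in>C. \<forall>j\<in>J. h j x \<le> 0}" and y: "y \<in> {x\<in>C. \<forall>j\<in>J. h j x \<le> 0}"
    and uv: "0 \<le> u" "0 \<le> v" "u + v = 1"
  have "h j (u *\<^sub>R x + v *\<^sub>R y) \<le> 0" if "j \<in> J" for j
  proof -
    have "h j (u *\<^sub>R x + v *\<^sub>R y) \<le> u * h j x + v * h j y"
      using assms(2)[OF that] x y uv unfolding convex_on_def by blast
    also have "\<dots> \<le> 0"
      using x y uv that by (auto intro!: add_nonpos_nonpos mult_nonneg_nonpos)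
    finally show ?thesis .
  qed
  with x y uv assms(1) show "u *\<^sub>R x + v *\<^sub>R y \<in> {x\<in>C. \<forall>j\<in>J. h j x \<le> 0}"
    by (auto intro: convexD)
qed

lemma convex_zero_set:
  assumes "affine_on C h"
  shows "convex {x\<in>C. h x = 0}"
  using assms unfolding convex_alt affine_on_def by auto

lemma rel_core_zero_set:
  assumes h: "affine_on C h" and z: "z \<in> rel_core C" "h z = 0"
  shows "z \<in> rel_core {x\<in>C. h x = 0}"
proof -
  have "\<exists>y\<in>{x\<in>C. h x = 0}. \<exists>t\<in>{0<..<1}. z = (1 - t) *\<^sub>R x + t *\<^sub>R y"
    if x: "x \<in> C" "h x = 0" for x
  proof -
    obtain y t where y: "y \<in> C" "t \<in> {0<..<1}" "z = (1 - t) *\<^sub>R x + t *\<^sub>R y"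
      using z(1) x(1) unfolding rel_core_def by blast
    then have "h z = (1 - t) * h x + t * h y"
      using h x(1) unfolding affine_on_def by auto
    then have "h y = 0" using x(2) z(2) y(2) by simp
    with y show ?thesis by blast
  qed
  with z show ?thesis by (auto simp: rel_core_def)
qed

text \<open>
  If \<open>h x > 0\<close>, then prolonging the segment from \<open>x\<close> to \<open>z\<close> beyond \<open>z\<close> leads to negative values of \<open>h\<close>.
\<close>

lemma affine_on_rel_core_opposite:
  assumes h: "affine_on C h" and z: "z \<in> rel_core C" "h z \<le> 0" and x: "x \<in> C" "h x > 0"
  obtains y where "y \<in> C" "h y < 0"
proof -
  obtain y t where y: "y \<in> C" "t \<in> {0<..<1}" "z = (1 - t) *\<^sub>R x + t *\<^sub>R y"
    using z(1) x(1) unfolding rel_core_def by blast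
  then have "h z = (1 - t) * h x + t * h y"
    using h x(1) unfolding affine_on_def by auto
  moreover have "(1 - t) * h x > 0" using y(2) x(2) by simp
  ultimately have "t * h y < 0" using z(2) by linarith
  then have "h y < 0" using y(2) by (simp add: mult_less_0_iff)
  with y(1) that show thesis by blast
qed

section \<open>A multiplier for a single constraint\<close>

text \<open>
  The number \<open>h x / (h x - h y)\<close> is the parameter at which linear interpolation between \<open>h x > 0\<close> and
  \<open>h y < 0\<close> crosses zero.
\<close>

lemma slope_inequality:
  fixes g h :: "'a::real_vector \<Rightarrow> real"
  assumes g: "convex_on C g" and xy: "x \<in> C" "y \<in> C" "h x > 0" "h y < 0"
    and t: "t = h x / (h x - h y)" and p: "p \<le> g ((1 - t) *\<^sub>R x + t *\<^sub>R y)"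
  shows "(p - g x) / h x \<le> (g y - p) / - h y"
proof -
  have d: "h x - h y > 0" using xy by linarith
  have t01: "0 \<le> t" "t \<le> 1" using xy d by (simp_all add: t)
  have "p \<le> (1 - t) * g x + t * g y"
    using p convex_onD[OF g t01 xy(1,2)] by linarith
  then have "p * (h x - h y) \<le> ((1 - t) * g x + t * g y) * (h x - h y)"
    using d by (simp add: mult_right_mono)
  also have "\<dots> = ((1 - t) * (h x - h y)) * g x + (t * (h x - h y)) * g y"
    by (simp add: algebra_simps)
  also have "t * (h x - h y) = h x" using t d by simp
  also have "(1 - t) * (h x - h y) = - h y" using t d by (simp add: field_simps)
  finally have "(p - g x) * (- h y) \<le> (g y - p) * h x"
    by (simp add: algebra_simps)
  then have "p - g x \<le> (g y - p) * h x / - h y"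
    using xy by (subst pos_le_divide_eq) auto
  then show ?thesis using xy by (subst pos_divide_le_eq) (auto simp: mult.commute)
qed

lemma crossing_point:
  fixes h :: "'a::real_vector \<Rightarrow> real"
  assumes xy: "x \<in> C" "y \<in> C" "h x > 0" "h y < 0" and t: "t = h x / (h x - h y)"
  shows "convex_on C h \<Longrightarrow> (1 - t) *\<^sub>R x + t *\<^sub>R y \<in> C \<and> h ((1 - t) *\<^sub>R x + t *\<^sub>R y) \<le> 0"
    and "affine_on C h \<Longrightarrow> (1 - t) *\<^sub>R x + t *\<^sub>R y \<in> C \<and> h ((1 - t) *\<^sub>R x + t *\<^sub>R y) = 0"
proof -
  have d: "h x - h y > 0" using xy by linarith
  have t01: "0 \<le> t" "t \<le> 1" using xy d by (simp_all add: t)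
  have 0: "(1 - t) * h x + t * h y = 0" using t d by (simp add: field_simps)
  have mem: "(1 - t) *\<^sub>R x + t *\<^sub>R y \<in> C" if "convex C"
    using that xy t01 by (simp add: convex_alt)
  show "(1 - t) *\<^sub>R x + t *\<^sub>R y \<in> C \<and> h ((1 - t) *\<^sub>R x + t *\<^sub>R y) \<le> 0" if "convex_on C h"
    using mem[OF convex_on_imp_convex[OF that]] convex_onD[OF that t01 xy(1,2)] 0 by simp
  show "(1 - t) *\<^sub>R x + t *\<^sub>R y \<in> C \<and> h ((1 - t) *\<^sub>R x + t *\<^sub>R y) = 0" if "affine_on C h"
    using that mem xy t01 0 by (simp add: affine_on_def)
qed

lemma real_between_sets:
  fixes A B :: "real set"
  assumes "A \<noteq> {}" "B \<noteq> {}" "\<forall>a\<in>A. \<forall>b\<in>B. a \<le> b"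
  shows "\<exists>m. (\<forall>a\<in>A. a \<le> m) \<and> (\<forall>b\<in>B. m \<le> b)"
proof (intro exI conjI ballI)
  have "bdd_above A" using assms unfolding bdd_above_def by blast
  then show "a \<le> Sup A" if "a \<in> A" for a using that by (rule cSup_upper[rotated])
  show "Sup A \<le> b" if "b \<in> B" for b using assms that by (intro cSup_least) auto
qed

lemma multiplier_from_slope_bounds:
  fixes g h :: "'a \<Rightarrow> real"
  assumes "\<And>x. x \<in> C \<Longrightarrow> h x > 0 \<Longrightarrow> (p - g x) / h x \<le> m"
    and "\<And>y. y \<in> C \<Longrightarrow> h y < 0 \<Longrightarrow> m \<le> (g y - p) / - h y"
    and "\<And>x. x \<in> C \<Longrightarrow> h x = 0 \<Longrightarrow> p \<le> g x"
    and x: "x \<in> C"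
  shows "p \<le> g x + m * h x"
proof (rule linorder_cases[of "h x" 0])
  assume "h x < 0"
  with assms(2)[OF x] show ?thesis by (simp add: field_simps)
next
  assume "h x > 0"
  with assms(1)[OF x] show ?thesis by (simp add: field_simps)
qed (use assms(3)[OF x] in simp)

lemma single_strict_multiplier:
  fixes g h :: "'a::real_vector \<Rightarrow> real"
  assumes g: "convex_on C g" and h: "convex_on C h"
    and y: "y \<in> C" "h y < 0"
    and p: "\<And>x. x \<in> C \<Longrightarrow> h x \<le> 0 \<Longrightarrow> p \<le> g x"
  obtains m where "0 \<le> m" "\<And>x. x \<in> C \<Longrightarrow> p \<le> g x + m * h x"
proof -
  \<comment> \<open>Adding \<open>0\<close> to the lower bounds makes the multiplier nonnegative.\<close>
  let ?A = "insert 0 ((\<lambda>x. (p - g x) / h x) ` {x\<in>C. h x > 0})"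
  let ?B = "(\<lambda>x. (g x - p) / - h x) ` {x\<in>C. h x < 0}"
  have AB: "\<forall>a\<in>?A. \<forall>b\<in>?B. a \<le> b"
  proof (intro ballI)
    fix a b assume a: "a \<in> ?A" and b: "b \<in> ?B"
    obtain v where v: "v \<in> C" "h v < 0" "b = (g v - p) / - h v" using b by blast
    have "0 \<le> b" unfolding v(3) using p[OF v(1)] v(2) by (intro divide_nonneg_pos) auto
    moreover have "(p - g x) / h x \<le> b" if "x \<in> C" "h x > 0" for x
      unfolding v(3)
      using slope_inequality[OF g that(1) v(1) that(2) v(2) refl]
        crossing_point(1)[OF that(1) v(1) that(2) v(2) refl h] p by blast
    ultimately show "a \<le> b" using a by blast
  qed
  have "?B \<noteq> {}" using y by blast
  from real_between_sets[OF insert_not_empty this AB]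
  obtain m where m: "\<forall>a\<in>?A. a \<le> m" "\<forall>b\<in>?B. m \<le> b"
    by (elim exE conjE)
  have "p \<le> g x + m * h x" if "x \<in> C" for x
    using that by (rule multiplier_from_slope_bounds[rotated 3]) (use m p in auto)
  moreover have "0 \<le> m" using m(1) by simp
  ultimately show thesis using that by blast
qed

text \<open>
  Either \<open>h\<close> vanishes on \<open>C\<close> and any multiplier will do, or \<open>h\<close> takes both signs because \<open>z\<close> is
  relatively interior, and then the slopes are bounded on both sides.
\<close>

lemma single_equality_multiplier:
  fixes g h :: "'a::real_vector \<Rightarrow> real"
  assumes g: "convex_on C g" and h: "affine_on C h"
    and z: "z \<in> rel_core C" "h z = 0"
    and p: "\<And>x. x \<in> C \<Longrightarrow> h x = 0 \<Longrightarrow> p \<le> g x"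
  obtains m where "\<And>x. x \<in> C \<Longrightarrow> p \<le> g x + m * h x"
proof (cases "\<forall>x\<in>C. h x = 0")
  case True
  with p that[of 0] show thesis by simp
next
  case False
  let ?A = "(\<lambda>x. (p - g x) / h x) ` {x\<in>C. h x > 0}"
  let ?B = "(\<lambda>x. (g x - p) / - h x) ` {x\<in>C. h x < 0}"
  have neg: "affine_on C (\<lambda>x. - h x)" using h by (auto simp: affine_on_def)
  have "(\<exists>x\<in>C. h x > 0) \<and> (\<exists>x\<in>C. h x < 0)"
  proof -
    from False obtain x where x: "x \<in> C" "h x > 0 \<or> h x < 0" by (meson linorder_neqE)
    from x(2) show ?thesis
    proof
      assume "h x > 0"
      with h z x(1) obtain y where "y \<in> C" "h y < 0"
        using affine_on_rel_core_opposite[of C h z x] by auto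
      with x(1) \<open>h x > 0\<close> show ?thesis by blast
    next
      assume "h x < 0"
      with neg z x(1) obtain y where "y \<in> C" "- h y < 0"
        using affine_on_rel_core_opposite[of C "\<lambda>x. - h x" z x] by auto
      with x(1) \<open>h x < 0\<close> show ?thesis by auto
    qed
  qed
  then have nonempty: "?A \<noteq> {}" "?B \<noteq> {}" by blast+
  have AB: "\<forall>a\<in>?A. \<forall>b\<in>?B. a \<le> b"
  proof (intro ballI)
    fix a b assume a: "a \<in> ?A" and b: "b \<in> ?B"
    obtain x where x: "x \<in> C" "h x > 0" "a = (p - g x) / h x" using a by blast
    obtain y where y: "y \<in> C" "h y < 0" "b = (g y - p) / - h y" using b by blast
    show "a \<le> b"
      unfolding x(3) y(3)
      using slope_inequality[OF g x(1) y(1) x(2) y(2) refl]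
        crossing_point(2)[OF x(1) y(1) x(2) y(2) refl h] p by blast
  qed
  from real_between_sets[OF nonempty AB]
  obtain m where m: "\<forall>a\<in>?A. a \<le> m" "\<forall>b\<in>?B. m \<le> b"
    by (elim exE conjE)
  have "p \<le> g x + m * h x" if "x \<in> C" for x
    using that by (rule multiplier_from_slope_bounds[rotated 3]) (use m p in auto)
  with that show thesis by blast
qed

section \<open>Multipliers for finitely many constraints\<close>

text \<open>
  The common strict point lies in every set cut out by some of the constraints, so it serves for the
  one-constraint lemma at each step.
\<close>

lemma strict_multipliers:
  fixes g :: "'a::real_vector \<Rightarrow> real"
  assumes "finite K" and "convex_on C g"
    and "\<And>k. k \<in> K \<Longrightarrow> convex_on C (h k)"
    and "z \<in> C" "\<And>k. k \<in> K \<Longrightarrow> h k z < 0"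
    and "\<And>x. x \<in> C \<Longrightarrow> \<forall>k\<in>K. h k x \<le> 0 \<Longrightarrow> p \<le> g x"
  shows "\<exists>m. (\<forall>k\<in>K. 0 \<le> m k) \<and> (\<forall>x\<in>C. p \<le> g x + (\<Sum>k\<in>K. m k * h k x))"
  using assms
proof (induction K arbitrary: g rule: finite_induct)
  case empty
  then show ?case by simp
next
  case (insert k K)
  let ?S = "{x\<in>C. \<forall>j\<in>K. h j x \<le> 0}"
  have S: "convex ?S"
    using insert.prems by (intro convex_sublevel convex_on_imp_convex[of C g]) auto
  have gS: "convex_on ?S g" and hS: "convex_on ?S (h k)"
    using S insert.prems by (auto intro: convex_on_subset)
  have zS: "z \<in> ?S" using insert.prems by (auto intro: less_imp_le)
  obtain m0 where m0: "0 \<le> m0" "\<And>x. x \<in> ?S \<Longrightarrow> p \<le> g x + m0 * h k x"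
    using single_strict_multiplier[OF gS hS zS, of p] insert.prems by auto
  have "convex_on C (\<lambda>x. g x + m0 * h k x)"
    using insert.prems m0 by (intro convex_on_add_scaled) auto
  then obtain m where m: "\<forall>j\<in>K. 0 \<le> m j"
    "\<forall>x\<in>C. p \<le> (g x + m0 * h k x) + (\<Sum>j\<in>K. m j * h j x)"
    using insert.IH[of "\<lambda>x. g x + m0 * h k x"] insert.prems m0 by auto
  have "(\<Sum>j\<in>K. (m(k := m0)) j * h j x) = (\<Sum>j\<in>K. m j * h j x)" for x
    using insert.hyps by (intro sum.cong) auto
  then have "(\<Sum>j\<in>insert k K. (m(k := m0)) j * h j x) = m0 * h k x + (\<Sum>j\<in>K. m j * h j x)" for x
    using insert.hyps by simp
  with m m0(1) insert.hyps show ?case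
    by (intro exI[of _ "m(k := m0)"]) (auto simp: add.assoc)
qed

text \<open>
  In the induction step a constraint \<open>a\<^sub>k \<le> 0\<close> is removed. If it can be strict on the set \<open>S\<close> cut out by the
  other constraints, the lemma for one strict constraint applies on \<open>S\<close>. Otherwise \<open>a\<^sub>k\<close> is
  nonnegative on \<open>S\<close>, and the induction hypothesis with \<open>a\<^sub>k\<close> as objective yields a nonnegative
  combination \<open>q = a\<^sub>k + \<Sum> \<lambda>\<^sub>j a\<^sub>j\<close> on \<open>C\<close>. Since \<open>q\<close> is nonpositive at the relatively interior point \<open>z\<close>, it vanishes
  on \<open>C\<close>, and \<open>a\<^sub>k z = 0\<close>. So \<open>z\<close> is also relatively interior to the slice \<open>a\<^sub>k = 0\<close> of \<open>C\<close>, where the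
  induction hypothesis yields multipliers for the other constraints.
\<close>

lemma affine_multipliers:
  fixes g :: "'a::real_vector \<Rightarrow> real"
  assumes "finite J" and "convex_on C g"
    and "\<And>j. j \<in> J \<Longrightarrow> affine_on C (a j)"
    and "z \<in> rel_core C" "\<And>j. j \<in> J \<Longrightarrow> a j z \<le> 0"
    and "\<And>x. x \<in> C \<Longrightarrow> \<forall>j\<in>J. a j x \<le> 0 \<Longrightarrow> p \<le> g x"
  shows "\<exists>m. (\<forall>j\<in>J. 0 \<le> m j) \<and> (\<forall>x\<in>C. p \<le> g x + (\<Sum>j\<in>J. m j * a j x))"
  using assms
proof (induction J arbitrary: C g p rule: finite_induct)
  case empty
  then show ?case by simp
next
  case (insert k J)
  note aff = insert.prems(2) and z = insert.prems(3) and az = insert.prems(4)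
  have C: "convex C" using insert.prems(1) by (rule convex_on_imp_convex)
  have zC: "z \<in> C" using z by (simp add: rel_core_def)
  have split: "(\<Sum>j\<in>insert k J. (m(k := m0)) j * a j x) = m0 * a k x + (\<Sum>j\<in>J. m j * a j x)"
    for m m0 x
  proof -
    have "(\<Sum>j\<in>J. (m(k := m0)) j * a j x) = (\<Sum>j\<in>J. m j * a j x)"
      using insert.hyps by (intro sum.cong) auto
    then show ?thesis using insert.hyps by simp
  qed
  let ?S = "{x\<in>C. \<forall>j\<in>J. a j x \<le> 0}"
  show ?case
  proof (cases "\<exists>y\<in>?S. a k y < 0")
    case True
    then obtain y where y: "y \<in> ?S" "a k y < 0" by blast
    have S: "convex ?S"
      using aff C by (intro convex_sublevel) (auto intro: affine_on_imp_convex_on)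
    have gS: "convex_on ?S g" and hS: "convex_on ?S (a k)"
      using S insert.prems(1) aff[of k] by (auto intro: convex_on_subset affine_on_imp_convex_on)
    obtain m0 where m0: "0 \<le> m0" "\<And>x. x \<in> ?S \<Longrightarrow> p \<le> g x + m0 * a k x"
      using single_strict_multiplier[OF gS hS y, of p] insert.prems(5) by auto
    have "convex_on C (\<lambda>x. g x + m0 * a k x)"
      using insert.prems(1) aff m0
      by (intro convex_on_add_scaled) (auto intro: affine_on_imp_convex_on)
    then obtain m where m: "\<forall>j\<in>J. 0 \<le> m j"
      "\<forall>x\<in>C. p \<le> (g x + m0 * a k x) + (\<Sum>j\<in>J. m j * a j x)"
      using insert.IH[of C "\<lambda>x. g x + m0 * a k x" p] insert.prems m0 by auto
    have "p \<le> g x + (\<Sum>j\<in>insert k J. (m(k := m0)) j * a j x)" if "x \<in> C" for x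
      using m(2) that unfolding split by (simp add: add.assoc)
    moreover have "\<forall>j\<in>insert k J. 0 \<le> (m(k := m0)) j" using m(1) m0(1) by auto
    ultimately show ?thesis by blast
  next
    case False
    have "\<exists>w. (\<forall>j\<in>J. 0 \<le> w j) \<and> (\<forall>x\<in>C. 0 \<le> a k x + (\<Sum>j\<in>J. w j * a j x))"
    proof (rule insert.IH)
      show "convex_on C (a k)" using aff by (simp add: affine_on_imp_convex_on)
      show "0 \<le> a k x" if "x \<in> C" "\<forall>j\<in>J. a j x \<le> 0" for x
        using False that by (auto simp: not_less)
    qed (use aff z az in auto)
    then obtain w where w: "\<forall>j\<in>J. 0 \<le> w j"
      "\<forall>x\<in>C. 0 \<le> a k x + (\<Sum>j\<in>J. w j * a j x)" by blast
    define q where "q x = a k x + (\<Sum>j\<in>J. w j * a j x)" for x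
    have q_eq: "q x = (\<Sum>j\<in>insert k J. (w(k := 1)) j * a j x)" for x
      unfolding q_def split by simp
    have q_aff: "affine_on C q"
      unfolding q_eq[abs_def] by (rule affine_on_lincomb[OF C aff])
    have sum_z: "(\<Sum>j\<in>J. w j * a j z) \<le> 0"
      using w(1) az by (intro sum_nonpos mult_nonneg_nonpos) auto
    have q0: "q x = 0" if x: "x \<in> C" for x
    proof (rule ccontr)
      assume "q x \<noteq> 0"
      then have "q x > 0" using w(2) x by (simp add: q_def order_less_le)
      moreover have "q z \<le> 0" using sum_z az[of k] by (simp add: q_def)
      ultimately obtain y where "y \<in> C" "q y < 0"
        using affine_on_rel_core_opposite[OF q_aff z _ x] by blast
      with w(2) show False by (fastforce simp: q_def)
    qed
    have akz: "a k z = 0"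
      using q0[OF zC] sum_z az[of k] by (simp add: q_def)
    have ak: "affine_on C (a k)" using aff by simp
    let ?H = "{x\<in>C. a k x = 0}"
    have H: "convex ?H" by (rule convex_zero_set[OF ak])
    have "\<exists>m. (\<forall>j\<in>J. 0 \<le> m j) \<and> (\<forall>x\<in>?H. p \<le> g x + (\<Sum>j\<in>J. m j * a j x))"
    proof (rule insert.IH)
      show "convex_on ?H g" using insert.prems(1) H by (auto intro: convex_on_subset)
      show "affine_on ?H (a j)" if "j \<in> J" for j
        using aff[of j] that H by (auto intro: affine_on_subset)
      show "z \<in> rel_core ?H" by (rule rel_core_zero_set[OF ak z akz])
      show "a j z \<le> 0" if "j \<in> J" for j using az that by simp
      show "p \<le> g x" if "x \<in> ?H" "\<forall>j\<in>J. a j x \<le> 0" for x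
        using insert.prems(5) that by auto
    qed
    then obtain m where m: "\<forall>j\<in>J. 0 \<le> m j"
      "\<forall>x\<in>?H. p \<le> g x + (\<Sum>j\<in>J. m j * a j x)" by blast
    have "convex_on C (\<lambda>x. g x + (\<Sum>j\<in>J. m j * a j x))"
      using C aff
      by (intro convex_on_add[OF insert.prems(1)] affine_on_imp_convex_on affine_on_lincomb) auto
    from single_equality_multiplier[OF this ak z akz, of p]
    obtain r where r: "\<And>x. x \<in> C \<Longrightarrow> p \<le> (g x + (\<Sum>j\<in>J. m j * a j x)) + r * a k x"
      using m(2) by auto
    \<comment> \<open>Adding \<open>\<bar>r\<bar>\<close> times the zero function \<open>q\<close> turns the multiplier \<open>r\<close> of \<open>a k\<close> into \<open>r + \<bar>r\<bar> \<ge> 0\<close>.\<close>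
    let ?m = "(\<lambda>j. m j + \<bar>r\<bar> * w j)(k := r + \<bar>r\<bar>)"
    have "(\<Sum>j\<in>insert k J. ?m j * a j x)
        = (\<Sum>j\<in>J. m j * a j x) + r * a k x + \<bar>r\<bar> * q x" for x
      unfolding split q_def by (simp add: algebra_simps sum.distrib sum_distrib_left)
    then have "p \<le> g x + (\<Sum>j\<in>insert k J. ?m j * a j x)" if "x \<in> C" for x
      using r[OF that] q0[OF that] by (simp only: add.assoc)
    moreover have "\<forall>j\<in>insert k J. 0 \<le> ?m j" using m(1) w(1) by auto
    ultimately show ?thesis by blast
  qed
qed

lemma equality_multipliers:
  fixes g :: "'a::real_vector \<Rightarrow> real"
  assumes "finite E" and "convex_on C g"
    and "\<And>i. i \<in> E \<Longrightarrow> affine_on C (a i)"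
    and "z \<in> rel_core C" "\<And>i. i \<in> E \<Longrightarrow> a i z = 0"
    and "\<And>x. x \<in> C \<Longrightarrow> \<forall>i\<in>E. a i x = 0 \<Longrightarrow> p \<le> g x"
  shows "\<exists>l. \<forall>x\<in>C. p \<le> g x + (\<Sum>i\<in>E. l i * a i x)"
  using assms
proof (induction E arbitrary: C rule: finite_induct)
  case empty
  then show ?case by simp
next
  case (insert k E)
  have C: "convex C" using insert.prems(1) by (rule convex_on_imp_convex)
  have ak: "affine_on C (a k)" "a k z = 0" using insert.prems by auto
  let ?H = "{x\<in>C. a k x = 0}"
  have H: "convex ?H" by (rule convex_zero_set[OF ak(1)])
  have "\<exists>l. \<forall>x\<in>?H. p \<le> g x + (\<Sum>i\<in>E. l i * a i x)"
  proof (rule insert.IH)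
    show "convex_on ?H g" using insert.prems(1) H by (auto intro: convex_on_subset)
    show "affine_on ?H (a j)" if "j \<in> E" for j
      using insert.prems(2)[of j] that H by (auto intro: affine_on_subset)
    show "z \<in> rel_core ?H" by (rule rel_core_zero_set[OF ak(1) insert.prems(3) ak(2)])
  qed (use insert.prems in auto)
  then obtain l where l: "\<forall>x\<in>?H. p \<le> g x + (\<Sum>i\<in>E. l i * a i x)" by blast
  have "convex_on C (\<lambda>x. g x + (\<Sum>i\<in>E. l i * a i x))"
    using insert.prems(2) C
    by (intro convex_on_add[OF insert.prems(1)] affine_on_imp_convex_on affine_on_lincomb) auto
  from single_equality_multiplier[OF this ak(1) insert.prems(3) ak(2), of p]
  obtain r where r: "\<And>x. x \<in> C \<Longrightarrow> p \<le> (g x + (\<Sum>i\<in>E. l i * a i x)) + r * a k x"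
    using l by auto
  have "(\<Sum>i\<in>E. (l(k := r)) i * a i x) = (\<Sum>i\<in>E. l i * a i x)" for x
    using insert.hyps by (intro sum.cong) auto
  then have "(\<Sum>i\<in>insert k E. (l(k := r)) i * a i x) = r * a k x + (\<Sum>i\<in>E. l i * a i x)" for x
    using insert.hyps by simp
  with r show ?case
    by (intro exI[of _ "l(k := r)"]) (simp add: algebra_simps)
qed

text \<open>
  The three kinds of constraints are dualised in the order strict, affine inequality, equality.
  The strict ones go first, relative to the set that all affine constraints cut out. Of that set
  \<open>z\<close> may well be a boundary point. The affine inequalities are then treated relative to the solutions
  of the equations, where \<open>z\<close> is still relatively interior.
\<close>

theorem lagrange_multipliers:
  fixes g :: "'a::real_vector \<Rightarrow> real"
  assumes fin: "finite E" "finite I" and J: "J \<subseteq> I" and g: "convex_on C g"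
    and h: "\<And>i. i \<in> I \<Longrightarrow> convex_on C (h i)" and aff: "\<And>i. i \<in> E \<union> J \<Longrightarrow> affine_on C (h i)"
    and z: "z \<in> rel_core C" and zE: "\<And>i. i \<in> E \<Longrightarrow> h i z = 0"
    and zJ: "\<And>j. j \<in> J \<Longrightarrow> h j z \<le> 0" and zK: "\<And>k. k \<in> I - J \<Longrightarrow> h k z < 0"
    and p: "\<And>x. x \<in> C \<Longrightarrow> \<forall>i\<in>E. h i x = 0 \<Longrightarrow> \<forall>i\<in>I. h i x \<le> 0 \<Longrightarrow> p \<le> g x"
  obtains l m where "\<forall>i\<in>I. 0 \<le> m i"
    "\<forall>x\<in>C. p \<le> g x + (\<Sum>i\<in>E. l i * h i x) + (\<Sum>i\<in>I. m i * h i x)"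
proof -
  have finJ: "finite J" and finK: "finite (I - J)" using fin J by (auto intro: finite_subset)
  have C: "convex C" using g by (rule convex_on_imp_convex)
  have zC: "z \<in> C" using z by (simp add: rel_core_def)
  let ?D = "{x\<in>C. \<forall>i\<in>E. h i x = 0}"
  have D: "convex ?D" and zD: "z \<in> rel_core ?D"
  proof -
    have "convex {x\<in>C. \<forall>i\<in>F. h i x = 0} \<and> z \<in> rel_core {x\<in>C. \<forall>i\<in>F. h i x = 0}"
      if "finite F" "F \<subseteq> E" for F
      using that
    proof (induction F rule: finite_induct)
      case empty
      then show ?case using C z by simp
    next
      case (insert i F)
      let ?F = "{x\<in>C. \<forall>i\<in>F. h i x = 0}"
      have F: "convex ?F" "z \<in> rel_core ?F" and i: "i \<in> E" using insert by auto
      have hi: "affine_on ?F (h i)"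
        by (rule affine_on_subset[OF aff _ F(1)]) (use i in auto)
      note convex_zero_set[OF hi] rel_core_zero_set[OF hi F(2) zE[OF i]]
      moreover have "{x\<in>C. \<forall>i\<in>insert i F. h i x = 0} = {x\<in>?F. h i x = 0}" by blast
      ultimately show ?case by simp
    qed
    from this[OF fin(1)] show "convex ?D" "z \<in> rel_core ?D" by simp_all
  qed
  let ?P = "{x\<in>?D. \<forall>j\<in>J. h j x \<le> 0}"
  have P: "convex ?P"
    using D aff J by (intro convex_sublevel affine_on_imp_convex_on) (auto intro: affine_on_subset)
  have "\<exists>m. (\<forall>k\<in>I - J. 0 \<le> m k) \<and> (\<forall>x\<in>?P. p \<le> g x + (\<Sum>k\<in>I - J. m k * h k x))"
  proof (rule strict_multipliers[OF finK])
    show "convex_on ?P g" using g P by (auto intro: convex_on_subset)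
    show "convex_on ?P (h k)" if "k \<in> I - J" for k
      using h[of k] that P by (auto intro: convex_on_subset)
    show "z \<in> ?P" using zC zE zJ by blast
    show "p \<le> g x" if "x \<in> ?P" "\<forall>k\<in>I - J. h k x \<le> 0" for x
      using p[of x] that by blast
    show "h k z < 0" if "k \<in> I - J" for k using that by (rule zK)
  qed
  then obtain mK where mK: "\<forall>k\<in>I - J. 0 \<le> mK k"
    "\<forall>x\<in>?P. p \<le> g x + (\<Sum>k\<in>I - J. mK k * h k x)" by blast
  let ?g = "\<lambda>x. g x + (\<Sum>k\<in>I - J. mK k * h k x)"
  have sumK: "convex_on C (\<lambda>x. \<Sum>k\<in>F. mK k * h k x)" if "finite F" "F \<subseteq> I - J" for F
    using that
  proof (induction F rule: finite_induct)
    case empty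
    then show ?case using C by (simp add: convex_on_const)
  next
    case (insert k F)
    then show ?case using mK(1) h by (auto intro!: convex_on_add convex_on_cmul)
  qed
  have gC: "convex_on C ?g" using g sumK[OF finK] by (intro convex_on_add) auto
  have "\<exists>m. (\<forall>j\<in>J. 0 \<le> m j) \<and> (\<forall>x\<in>?D. p \<le> ?g x + (\<Sum>j\<in>J. m j * h j x))"
  proof (rule affine_multipliers[OF finJ])
    show "convex_on ?D ?g" using gC D by (auto intro: convex_on_subset)
    show "affine_on ?D (h j)" if "j \<in> J" for j
      using aff[of j] that D by (auto intro: affine_on_subset)
    show "z \<in> rel_core ?D" by (rule zD)
    show "h j z \<le> 0" if "j \<in> J" for j using that by (rule zJ)
    show "p \<le> ?g x" if "x \<in> ?D" "\<forall>j\<in>J. h j x \<le> 0" for x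
      using mK(2) that by blast
  qed
  then obtain mJ where mJ: "\<forall>j\<in>J. 0 \<le> mJ j"
    "\<forall>x\<in>?D. p \<le> ?g x + (\<Sum>j\<in>J. mJ j * h j x)" by blast
  have "convex_on C (\<lambda>x. ?g x + (\<Sum>j\<in>J. mJ j * h j x))"
    using gC C aff by (intro convex_on_add[OF gC] affine_on_imp_convex_on affine_on_lincomb) auto
  then have "\<exists>l. \<forall>x\<in>C. p \<le> (?g x + (\<Sum>j\<in>J. mJ j * h j x)) + (\<Sum>i\<in>E. l i * h i x)"
  proof (rule equality_multipliers[OF fin(1)])
    show "affine_on C (h i)" if "i \<in> E" for i using aff that by blast
    show "p \<le> ?g x + (\<Sum>j\<in>J. mJ j * h j x)" if "x \<in> C" "\<forall>i\<in>E. h i x = 0" for x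
      using mJ(2) that by blast
  qed (fact z, fact zE)
  then obtain l where l: "\<forall>x\<in>C. p \<le> (?g x + (\<Sum>j\<in>J. mJ j * h j x)) + (\<Sum>i\<in>E. l i * h i x)"
    by blast
  let ?m = "\<lambda>i. if i \<in> J then mJ i else mK i"
  have "(\<Sum>i\<in>I. ?m i * h i x) = (\<Sum>k\<in>I - J. mK k * h k x) + (\<Sum>j\<in>J. mJ j * h j x)" for x
    unfolding sum.subset_diff[OF J fin(2)] by (intro arg_cong2[of _ _ _ _ "(+)"] sum.cong) auto
  then have bound: "\<forall>x\<in>C. p \<le> g x + (\<Sum>i\<in>E. l i * h i x) + (\<Sum>i\<in>I. ?m i * h i x)"
    using l by (simp add: algebra_simps)
  have nonneg: "\<forall>i\<in>I. 0 \<le> ?m i" using mJ(1) mK(1) by auto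
  show thesis by (rule that[OF nonneg bound])
qed

section \<open>Extended-real convex functions on their domain\<close>

lemma convex_fun_eff_dom:
  assumes "convex_fun g"
  shows "convex (eff_dom g)"
  unfolding convex_alt
proof (intro ballI allI impI)
  fix x y and t :: real
  assume xy: "x \<in> eff_dom g" "y \<in> eff_dom g" and t: "0 \<le> t \<and> t \<le> 1"
  show "(1 - t) *\<^sub>R x + t *\<^sub>R y \<in> eff_dom g"
  proof (cases "t = 0 \<or> t = 1")
    case False
    then have t': "t \<in> {0<..<1}" using t by auto
    have "g ((1 - t) *\<^sub>R x + t *\<^sub>R y) \<le> ereal (1 - t) * g x + ereal t * g y"
      using assms t' unfolding convex_fun_def by blast
    also have "\<dots> < \<infinity>"
      using xy t' by (cases "g x"; cases "g y") (auto simp: eff_dom_def)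
    finally show ?thesis by (simp add: eff_dom_def)
  qed (use xy in auto)
qed

lemma convex_on_real_of_convex_fun:
  assumes g: "convex_fun g" "proper_fun g" and C: "convex C" "C \<subseteq> eff_dom g"
  shows "convex_on C (\<lambda>x. real_of_ereal (g x))"
proof (rule convex_onI)
  fix x y and t :: real
  assume t: "0 < t" "t < 1" and xy: "x \<in> C" "y \<in> C"
  have *: "g u = ereal (real_of_ereal (g u))" if "u \<in> C" for u
    using that C(2) g(2) by (cases "g u") (auto simp: proper_fun_def eff_dom_def)
  have "(1 - t) *\<^sub>R x + t *\<^sub>R y \<in> C" using C(1) xy t by (simp add: convex_alt)
  then have "ereal (real_of_ereal (g ((1 - t) *\<^sub>R x + t *\<^sub>R y))) = g ((1 - t) *\<^sub>R x + t *\<^sub>R y)"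
    using * by simp
  also have "\<dots> \<le> ereal (1 - t) * g x + ereal t * g y"
    using g(1) t unfolding convex_fun_def by auto
  also have "\<dots> = ereal ((1 - t) * real_of_ereal (g x) + t * real_of_ereal (g y))"
    by (subst *[OF xy(1)], subst *[OF xy(2)]) simp
  finally show "real_of_ereal (g ((1 - t) *\<^sub>R x + t *\<^sub>R y))
      \<le> (1 - t) * real_of_ereal (g x) + t * real_of_ereal (g y)" by simp
qed (rule C(1))

lemma affine_on_real_of_affine_fun:
  assumes "affine_fun g" "convex C"
  shows "affine_on C (\<lambda>x. real_of_ereal (g x))"
  using assms by (auto simp: affine_fun_def affine_on_def inner_simps algebra_simps)

section \<open>The augmented Lagrangian\<close>

text \<open>
  The right-hand side is the maximum over \<open>s \<ge> 0\<close> of \<open>s c - (s - m)\<^sup>2 / (2 \<rho>)\<close>, attained at \<open>s = [m + \<rho> c]\<^sub>+\<close>;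
  the choice \<open>s = m\<close> gives the bound.
\<close>

lemma penalty_ge_linear:
  fixes m c \<rho> :: real
  assumes "0 \<le> m" "0 < \<rho>"
  shows "m * c \<le> \<rho> / 2 * ((max (m / \<rho> + c) 0)\<^sup>2 - m\<^sup>2 / \<rho>\<^sup>2)"
proof (cases "m / \<rho> + c \<ge> 0")
  case True
  have "\<rho> / 2 * ((m / \<rho> + c)\<^sup>2 - m\<^sup>2 / \<rho>\<^sup>2) = m * c + \<rho> / 2 * c\<^sup>2"
    using assms by (simp add: power2_eq_square field_simps)
  moreover have "0 \<le> \<rho> / 2 * c\<^sup>2" using assms by simp
  ultimately show ?thesis using True by (simp add: max_absorb1)
next
  case False
  then have "m * c \<le> m * (- (m / \<rho>))" using assms by (intro mult_left_mono) auto
  also have "\<dots> \<le> \<rho> / 2 * (0 - m\<^sup>2 / \<rho>\<^sup>2)"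
    using assms by (simp add: power2_eq_square field_simps)
  finally show ?thesis using False by (simp add: max_absorb2)
qed

lemma penalty_nonpos:
  fixes m c \<rho> :: real
  assumes "c \<le> 0" "0 < \<rho>"
  shows "(max (m / \<rho> + c) 0)\<^sup>2 \<le> m\<^sup>2 / \<rho>\<^sup>2"
proof -
  have "\<bar>max (q + c) 0\<bar> \<le> \<bar>q\<bar>" for q :: real using assms(1) by auto
  then have "(max (m / \<rho> + c) 0)\<^sup>2 \<le> (m / \<rho>)\<^sup>2" by (simp only: abs_le_square_iff)
  then show ?thesis by (simp add: power_divide)
qed

lemma aug_lagrangian_finite:
  fixes f :: "'a \<Rightarrow> ereal"
  assumes "f x = ereal r" "\<forall>i\<in>E \<union> I. c i x = ereal (h i)"
  shows "aug_lagrangian E I f c \<rho> x l \<mu> =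
    ereal (r + (\<Sum>i\<in>E. l i * h i) + \<rho> / 2 * (\<Sum>i\<in>E. (h i)\<^sup>2)
         + \<rho> / 2 * (\<Sum>i\<in>I. (max (\<mu> i / \<rho> + h i) 0)\<^sup>2 - (\<mu> i)\<^sup>2 / \<rho>\<^sup>2))"
proof -
  have "(\<Sum>i\<in>E. ereal (l i) * c i x) = (\<Sum>i\<in>E. ereal (l i * h i))"
    using assms(2) by (intro sum.cong) auto
  moreover have "(\<Sum>i\<in>E. (c i x)\<^sup>2) = (\<Sum>i\<in>E. ereal ((h i)\<^sup>2))"
    using assms(2) by (intro sum.cong) auto
  moreover have "(\<Sum>i\<in>I. (max (ereal (\<mu> i / \<rho>) + c i x) 0)\<^sup>2 - ereal ((\<mu> i)\<^sup>2 / \<rho>\<^sup>2))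
      = (\<Sum>i\<in>I. ereal ((max (\<mu> i / \<rho> + h i) 0)\<^sup>2 - (\<mu> i)\<^sup>2 / \<rho>\<^sup>2))"
  proof (rule sum.cong[OF refl])
    fix i assume "i \<in> I"
    then have "max (ereal (\<mu> i / \<rho>) + c i x) 0 = ereal (max (\<mu> i / \<rho> + h i) 0)"
      using assms(2) by (simp add: zero_ereal_def)
    then show "(max (ereal (\<mu> i / \<rho>) + c i x) 0)\<^sup>2 - ereal ((\<mu> i)\<^sup>2 / \<rho>\<^sup>2)
        = ereal ((max (\<mu> i / \<rho> + h i) 0)\<^sup>2 - (\<mu> i)\<^sup>2 / \<rho>\<^sup>2)"
      by (simp only: ereal_power ereal_minus(1))
  qed
  ultimately show ?thesis
    unfolding aug_lagrangian_def assms(1) by (simp only: sum_ereal times_ereal.simps plus_ereal.simps)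
qed

text \<open>
  The equality terms are finite and the penalty terms are bounded below, so nothing can cancel an
  infinite value of \<open>f\<close> or of an inequality constraint.
\<close>

lemma aug_lagrangian_outside_dom:
  fixes f :: "'a \<Rightarrow> ereal"
  assumes fin: "finite I" and \<rho>: "\<rho> > 0"
    and E: "\<And>i. i \<in> E \<Longrightarrow> \<bar>c i x\<bar> \<noteq> \<infinity>"
    and I: "\<And>i. i \<in> I \<Longrightarrow> c i x \<noteq> -\<infinity>" and f: "f x \<noteq> -\<infinity>"
    and x: "x \<notin> problem_dom E I f c"
  shows "aug_lagrangian E I f c \<rho> x l \<mu> = \<infinity>"
proof -
  have linear: "(\<Sum>i\<in>E. ereal (l i) * c i x) = ereal (\<Sum>i\<in>E. l i * real_of_ereal (c i x))"
    unfolding sum_ereal[symmetric]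
  proof (rule sum.cong[OF refl])
    fix i assume "i \<in> E"
    with E[of i] show "ereal (l i) * c i x = ereal (l i * real_of_ereal (c i x))"
      by (cases "c i x") auto
  qed
  have "(\<Sum>i\<in>E. (c i x)\<^sup>2) = (\<Sum>i\<in>E. ereal ((real_of_ereal (c i x))\<^sup>2))"
  proof (rule sum.cong[OF refl])
    fix i assume "i \<in> E"
    with E[of i] show "(c i x)\<^sup>2 = ereal ((real_of_ereal (c i x))\<^sup>2)" by (cases "c i x") auto
  qed
  then have square: "ereal (\<rho> / 2) * (\<Sum>i\<in>E. (c i x)\<^sup>2)
      = ereal (\<rho> / 2 * (\<Sum>i\<in>E. (real_of_ereal (c i x))\<^sup>2))" by simp
  let ?pen = "\<lambda>i. (max (ereal (\<mu> i / \<rho>) + c i x) 0)\<^sup>2 - ereal ((\<mu> i)\<^sup>2 / \<rho>\<^sup>2)"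
  have pen_fin: "?pen i \<noteq> -\<infinity>" for i
  proof -
    have "0 \<le> (max (ereal (\<mu> i / \<rho>) + c i x) 0)\<^sup>2" by (simp add: zero_le_power)
    then show ?thesis by (cases "(max (ereal (\<mu> i / \<rho>) + c i x) 0)\<^sup>2") auto
  qed
  have sum_fin: "(\<Sum>i\<in>I. ?pen i) \<noteq> -\<infinity>" using pen_fin by (induction I rule: infinite_finite_induct) auto
  from x consider "f x = \<infinity>" | i where "i \<in> E \<union> I" "c i x = \<infinity>"
    by (auto simp: problem_dom_def eff_dom_def)
  then show ?thesis
  proof cases
    case 1
    have "ereal (\<rho> / 2) * (\<Sum>i\<in>I. ?pen i) \<noteq> -\<infinity>"
      using sum_fin \<rho> by (cases "\<Sum>i\<in>I. ?pen i") auto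
    then show ?thesis unfolding aug_lagrangian_def linear square 1 by simp
  next
    case (2 i)
    then have i: "i \<in> I" "c i x = \<infinity>" using E[of i] by auto
    have "?pen i = \<infinity>" using i(2) by (simp add: power2_eq_square max_def)
    then have "(\<Sum>i\<in>I. ?pen i) = \<infinity>" using fin i(1) by (subst sum_Pinfty) blast
    then have "ereal (\<rho> / 2) * (\<Sum>i\<in>I. ?pen i) = \<infinity>" using \<rho> by simp
    then show ?thesis unfolding aug_lagrangian_def by simp
  qed
qed

lemma aug_lagrangian_le_objective:
  fixes f :: "'a \<Rightarrow> ereal"
  assumes \<rho>: "\<rho> > 0" and x: "x \<in> feasible_set E I c"
    and c: "\<And>i. i \<in> I \<Longrightarrow> c i x \<noteq> -\<infinity>" and f: "f x \<noteq> -\<infinity>"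
  shows "aug_lagrangian E I f c \<rho> x l \<mu> \<le> f x"
proof (cases "f x")
  case (real r)
  define h where "h i = real_of_ereal (c i x)" for i
  have h: "\<forall>i\<in>E \<union> I. c i x = ereal (h i)"
  proof
    fix i assume "i \<in> E \<union> I"
    with x c[of i] show "c i x = ereal (h i)"
      unfolding h_def by (cases "c i x") (auto simp: feasible_set_def zero_ereal_def)
  qed
  have hE: "h i = 0" if "i \<in> E" for i
    using x that by (simp add: h_def feasible_set_def)
  have hI: "h i \<le> 0" if "i \<in> I" for i
    using x that h by (auto simp: feasible_set_def)
  have "(\<Sum>i\<in>I. (max (\<mu> i / \<rho> + h i) 0)\<^sup>2 - (\<mu> i)\<^sup>2 / \<rho>\<^sup>2) \<le> 0"
    using penalty_nonpos[OF hI \<rho>] by (intro sum_nonpos) auto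
  then have "\<rho> / 2 * (\<Sum>i\<in>I. (max (\<mu> i / \<rho> + h i) 0)\<^sup>2 - (\<mu> i)\<^sup>2 / \<rho>\<^sup>2) \<le> 0"
    using \<rho> by (simp add: mult_le_0_iff)
  then show ?thesis
    unfolding aug_lagrangian_finite[of f x r E I c h, OF real h] real
    using hE by simp
qed (use f in auto)

section \<open>Strong duality\<close>

theorem theorem2p8:
  fixes f :: "real ^ 'n \<Rightarrow> ereal"
    and c :: "'i \<Rightarrow> real ^ 'n \<Rightarrow> ereal"
    and E I :: "'i set"
    and \<rho> :: real
  assumes "finite E" and "finite I" and "E \<inter> I = {}"
    and "proper_fun f" and "lsc_fun f"
    and "\<And>i. i \<in> E \<union> I \<Longrightarrow> proper_fun (c i)"
    and "\<And>i. i \<in> E \<union> I \<Longrightarrow> lsc_fun (c i)"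
    and "convex_problem E I f c"
    and "slater_condition E I f c"
    and "\<rho> > 0"
  shows "(SUP (l, \<mu>)\<in>multipliers E I. INF x. aug_lagrangian E I f c \<rho> x l \<mu>)
       = (INF x. SUP (l, \<mu>)\<in>multipliers E I. aug_lagrangian E I f c \<rho> x l \<mu>)"
proof -
  let ?L = "\<lambda>x l \<mu>. aug_lagrangian E I f c \<rho> x l \<mu>"
  let ?C = "problem_dom E I f c"
  define P where "P = (INF x\<in>feasible_set E I c. f x)"
  have f: "convex_fun f" and cI: "\<And>i. i \<in> I \<Longrightarrow> convex_fun (c i)"
    and cE: "\<And>i. i \<in> E \<Longrightarrow> affine_fun (c i)"
    using assms(8) by (auto simp: convex_problem_def)
  have c_fin: "c i x \<noteq> -\<infinity>" if "i \<in> E \<union> I" for i x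
    using assms(6)[OF that] by (simp add: proper_fun_def)
  have f_fin: "f x \<noteq> -\<infinity>" for x using assms(4) by (simp add: proper_fun_def)
  have cE_fin: "\<bar>c i x\<bar> \<noteq> \<infinity>" if "i \<in> E" for i x
    using cE[OF that] by (auto simp: affine_fun_def)

  have weak: "(SUP (l, \<mu>)\<in>multipliers E I. INF x. ?L x l \<mu>)
      \<le> (INF x. SUP (l, \<mu>)\<in>multipliers E I. ?L x l \<mu>)"
  proof (intro SUP_least INF_greatest)
    fix lm x assume lm: "lm \<in> multipliers E I"
    obtain l \<mu> where eq: "lm = (l, \<mu>)" by (cases lm)
    have "(INF x. ?L x l \<mu>) \<le> ?L x l \<mu>" by (rule INF_lower[OF UNIV_I])
    also have "\<dots> \<le> (SUP (l, \<mu>)\<in>multipliers E I. ?L x l \<mu>)"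
      by (rule SUP_upper2[OF lm]) (simp add: eq)
    finally show "(case lm of (l, \<mu>) \<Rightarrow> INF x. ?L x l \<mu>) \<le> (SUP (l, \<mu>)\<in>multipliers E I. ?L x l \<mu>)"
      by (simp add: eq)
  qed

  have upper: "(INF x. SUP (l, \<mu>)\<in>multipliers E I. ?L x l \<mu>) \<le> P"
    unfolding P_def
  proof (rule INF_greatest)
    fix x assume x: "x \<in> feasible_set E I c"
    have "?L x l \<mu> \<le> f x" for l \<mu>
      by (rule aug_lagrangian_le_objective[OF assms(10) x]) (use c_fin f_fin in auto)
    then have "(SUP (l, \<mu>)\<in>multipliers E I. ?L x l \<mu>) \<le> f x"
      by (intro SUP_least) (simp add: case_prod_beta)
    moreover have "(INF x. SUP (l, \<mu>)\<in>multipliers E I. ?L x l \<mu>)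
        \<le> (SUP (l, \<mu>)\<in>multipliers E I. ?L x l \<mu>)"
      by (rule INF_lower[OF UNIV_I])
    ultimately show "(INF x. SUP (l, \<mu>)\<in>multipliers E I. ?L x l \<mu>) \<le> f x"
      by (rule order_trans[rotated])
  qed

  have lower: "P \<le> (SUP (l, \<mu>)\<in>multipliers E I. INF x. ?L x l \<mu>)"
  proof (cases "P = -\<infinity>")
    case False
    obtain J z where J: "J \<subseteq> I" "\<forall>j\<in>J. affine_fun (c j)"
      and z: "z \<in> feasible_set E I c" "z \<in> rel_interior ?C"
        "\<forall>j\<in>J. c j z \<le> 0" "\<forall>k\<in>I - J. c k z < 0"
      using assms(9) unfolding slater_condition_def by blast
    have "c i x < \<infinity>" if "i \<in> E" for i x
      using cE_fin[OF that, of x] by (cases "c i x") auto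
    then have "eff_dom (c i) = UNIV" if "i \<in> E" for i
      using that by (auto simp: eff_dom_def)
    then have "?C = (\<Inter>i\<in>I. eff_dom (c i)) \<inter> eff_dom f"
      by (auto simp: problem_dom_def)
    then have C: "convex ?C"
      using cI f by (auto intro!: convex_Int convex_INT convex_fun_eff_dom)
    have z_core: "z \<in> rel_core ?C" using rel_interior_subset_rel_core[OF C] z(2) by blast
    define g where "g x = real_of_ereal (f x)" for x
    define h where "h i x = real_of_ereal (c i x)" for i x
    have g: "f x = ereal (g x)" if "x \<in> ?C" for x
      using that f_fin[of x] unfolding g_def
      by (cases "f x") (auto simp: problem_dom_def eff_dom_def)
    have h: "c i x = ereal (h i x)" if "x \<in> ?C" "i \<in> E \<union> I" for i x
      using that c_fin[OF that(2), of x] unfolding h_def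
      by (cases "c i x") (auto simp: problem_dom_def eff_dom_def)
    have zC: "z \<in> ?C" using z_core by (simp add: rel_core_def)
    have "P \<le> f z" unfolding P_def using z(1) by (rule INF_lower)
    with False g[OF zC] obtain p where p: "P = ereal p" by (cases P) auto
    obtain l m where lm: "\<forall>i\<in>I. 0 \<le> m i"
      "\<forall>x\<in>?C. p \<le> g x + (\<Sum>i\<in>E. l i * h i x) + (\<Sum>i\<in>I. m i * h i x)"
    proof (rule lagrange_multipliers[OF assms(1,2) J(1), of ?C g h z p])
      show "convex_on ?C g"
        unfolding g_def using f assms(4) C
        by (intro convex_on_real_of_convex_fun) (auto simp: problem_dom_def)
      show "convex_on ?C (h i)" if "i \<in> I" for i
        unfolding h_def using cI[OF that] assms(6)[of i] C that
        by (intro convex_on_real_of_convex_fun) (auto simp: problem_dom_def)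
      show "affine_on ?C (h i)" if "i \<in> E \<union> J" for i
        unfolding h_def using cE J(2) C that by (intro affine_on_real_of_affine_fun) auto
      show "z \<in> rel_core ?C" by (rule z_core)
      show "h i z = 0" if "i \<in> E" for i
        using z(1) that by (simp add: h_def feasible_set_def)
      show "h j z \<le> 0" if "j \<in> J" for j
      proof -
        have "c j z \<le> 0" using z(3) that by blast
        moreover have "c j z = ereal (h j z)" using h[OF zC, of j] J(1) that by blast
        ultimately show ?thesis by simp
      qed
      show "h k z < 0" if "k \<in> I - J" for k
      proof -
        have "c k z < 0" using z(4) that by blast
        moreover have "c k z = ereal (h k z)" using h[OF zC, of k] that by blast
        ultimately show ?thesis by simp
      qed
      show "p \<le> g x" if "x \<in> ?C" "\<forall>i\<in>E. h i x = 0" "\<forall>i\<in>I. h i x \<le> 0" for x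
      proof -
        have "x \<in> feasible_set E I c"
          using that h[OF that(1)] by (auto simp: feasible_set_def zero_ereal_def)
        then have "P \<le> f x" unfolding P_def by (rule INF_lower)
        then show ?thesis using p g[OF that(1)] by simp
      qed
    qed (rule that)
    define l' \<mu>' where "l' = restrict l E" and "\<mu>' = restrict m I"
    have mem: "(l', \<mu>') \<in> multipliers E I" by (auto simp: l'_def \<mu>'_def multipliers_def)
    have "P \<le> ?L x l' \<mu>'" for x
    proof (cases "x \<in> ?C")
      case True
      then have hx: "\<forall>i\<in>E \<union> I. c i x = ereal (h i x)" using h by blast
      have "(\<Sum>i\<in>I. m i * h i x)
          \<le> (\<Sum>i\<in>I. \<rho> / 2 * ((max (\<mu>' i / \<rho> + h i x) 0)\<^sup>2 - (\<mu>' i)\<^sup>2 / \<rho>\<^sup>2))"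
        using lm(1) penalty_ge_linear[OF _ assms(10)] by (intro sum_mono) (auto simp: \<mu>'_def)
      moreover have "(\<Sum>i\<in>E. l' i * h i x) = (\<Sum>i\<in>E. l i * h i x)" by (simp add: l'_def)
      moreover have "0 \<le> \<rho> / 2 * (\<Sum>i\<in>E. (h i x)\<^sup>2)" using assms(10) by (simp add: sum_nonneg)
      moreover have "p \<le> g x + (\<Sum>i\<in>E. l i * h i x) + (\<Sum>i\<in>I. m i * h i x)"
        using lm(2) True by blast
      ultimately show ?thesis
        unfolding p aug_lagrangian_finite[of f x "g x" E I c "\<lambda>i. h i x", OF g[OF True] hx]
        by (simp add: sum_distrib_left)
    next
      case False
      then have "?L x l' \<mu>' = \<infinity>"
        using assms(2,10) cE_fin c_fin f_fin by (intro aug_lagrangian_outside_dom) auto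
      then show ?thesis by simp
    qed
    then have "P \<le> (INF x. ?L x l' \<mu>')" by (rule INF_greatest)
    then show ?thesis by (intro SUP_upper2[OF mem]) simp
  qed simp
  from weak upper lower show ?thesis by (meson order_antisym order_trans)
qed

end
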